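(* Let $\mu$ be a finite positive Borel measure on the interval $[0,1)$. If $0<\alpha<1$ and $0<\beta<2$, then the following conditions are equivalent. (1) $\mathcal{C}_\mu:\mathcal{B}^{\alpha}\to\mathcal{B}^{\beta}$ is bounded. (2) $\mathcal{C}_\mu:\mathcal{B}^{\alpha}\to\mathcal{B}^{\beta}$ is compact. (3) The measure $\mu$ is a $(2-\beta)$-Carleson measure.
   Context: Let $\mathbb{D}=\{z\in\mathbb{C}:|z|<1\}$ and let $H(\mathbb{D})$ be the space of all analytic functions in $\mathbb{D}$. For $0<\alpha<\infty$, the Bloch-type space is $\mathcal{B}^{\alpha}=\{f\in H(\mathbb{D}):\|f\|_{\mathcal{B}^\alpha}=|f(0)|+\sup_{z\in\mathbb{D}}(1-|z|^2)^{\alpha}|f'(z)|<\infty\}$. For a finite positive Borel measure $\mu$ on $[0,1)$ and $f(z)=\sum_{n=0}^\infty a_nz^n\in H(\mathbb{D})$, the Cesàro-like operator is $$\mathcal{C}_\mu(f)(z)=\sum_{n=0}^\infty\left(\mu_n\sum_{k=0}^n a_k\right)z^n=\int_{[0,1)}\frac{f(tz)}{1-tz}\,d\mu(t),\quad z\in\mathbb{D},$$ where $\mu_n=\int_{[0,1)}t^n\,d\mu(t)$. For $0<s<\infty$, a positive Borel measure $\nu$ on $\mathbb{D}$ is an $s$-Carleson measure if $\sup_{I\subset\partial\mathbb{D}}\nu(S(I))/|I|^s<\infty$, where $I$ ranges over arcs, $|I|$ is the length of $I$, and $S(I)=\{re^{i\vartheta}:e^{i\vartheta}\in I,\ 1-\frac{|I|}{2\pi}\le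 r<1\}$. A measure $\mu$ on $[0,1)$ is regarded as a measure on $\mathbb{D}$ via $\overline{\mu}(E)=\mu(E\cap[0,1))$; thus $\mu$ is an $s$-Carleson measure if and only if there is a constant $M>0$ with $\mu([t,1))\le M(1-t)^s$ for all $0\le t<1$. *)

theory Defs
  imports "HOL-Complex_Analysis.Complex_Analysis"
begin

text \<open>
  Analytic functions in the unit disc are total functions that are holomorphic on
  \<^term>\<open>ball (0::complex) 1\<close>; their values outside the disc are arbitrary, and nothing below
  depends on them.
\<close>

definition bloch_space :: "real \<Rightarrow> (complex \<Rightarrow> complex) set" where
  "bloch_space \<alpha> = {f. f holomorphic_on ball 0 1 \<and>
     bdd_above ((\<lambda>z. (1 - (cmod z)\<^sup>2) powr \<alpha> * cmod (deriv f z)) ` ball 0 1)}"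

definition bloch_norm :: "real \<Rightarrow> (complex \<Rightarrow> complex) \<Rightarrow> real" where
  "bloch_norm \<alpha> f =
     cmod (f 0) + (SUP z\<in>ball 0 1. (1 - (cmod z)\<^sup>2) powr \<alpha> * cmod (deriv f z))"

definition taylor_coeff :: "(complex \<Rightarrow> complex) \<Rightarrow> nat \<Rightarrow> complex" where
  "taylor_coeff f n = (deriv ^^ n) f 0 / fact n"

definition moment :: "real measure \<Rightarrow> nat \<Rightarrow> real" where
  "moment \<mu> n = (\<integral>t. t ^ n \<partial>\<mu>)"

definition cesaro_like :: "real measure \<Rightarrow> (complex \<Rightarrow> complex) \<Rightarrow> complex \<Rightarrow> complex" where
  "cesaro_like \<mu> f z =
     (\<Sum>n. (complex_of_real (moment \<mu> n) * (\<Sum>k\<le>n. taylor_coeff f k)) * z ^ n)"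

text \<open>
  Boundedness and compactness include that the operator maps the first space into the second.
\<close>

definition bloch_bounded_operator ::
    "real \<Rightarrow> real \<Rightarrow> ((complex \<Rightarrow> complex) \<Rightarrow> complex \<Rightarrow> complex) \<Rightarrow> bool" where
  "bloch_bounded_operator \<alpha> \<beta> T \<longleftrightarrow>
     (\<forall>f\<in>bloch_space \<alpha>. T f \<in> bloch_space \<beta>) \<and>
     (\<exists>C. \<forall>f\<in>bloch_space \<alpha>. bloch_norm \<beta> (T f) \<le> C * bloch_norm \<alpha> f)"

definition bloch_compact_operator ::
    "real \<Rightarrow> real \<Rightarrow> ((complex \<Rightarrow> complex) \<Rightarrow> complex \<Rightarrow> complex) \<Rightarrow> bool" where
  "bloch_compact_operator \<alpha> \<beta> T \<longleftrightarrow>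
     (\<forall>f\<in>bloch_space \<alpha>. T f \<in> bloch_space \<beta>) \<and>
     (\<forall>F :: nat \<Rightarrow> complex \<Rightarrow> complex.
        (\<forall>n. F n \<in> bloch_space \<alpha>) \<and> (\<exists>C. \<forall>n. bloch_norm \<alpha> (F n) \<le> C) \<longrightarrow>
        (\<exists>g\<in>bloch_space \<beta>. \<exists>r :: nat \<Rightarrow> nat. strict_mono r \<and>
           (\<lambda>n. bloch_norm \<beta> (\<lambda>z. T (F (r n)) z - g z)) \<longlonglongrightarrow> 0))"

text \<open>
  An arc \<open>I\<close> of the unit circle is given by an interval \<open>J\<close> of angles, open, closed or half-open,
  with \<open>I = cis ` J\<close>. As \<open>J\<close> has length at most \<open>2 * pi\<close>, the length of \<open>I\<close> is that of \<open>J\<close>.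
\<close>

definition arc_angles :: "real set set" where
  "arc_angles = {J. is_interval J \<and> bounded J \<and>
     0 < measure lborel J \<and> measure lborel J \<le> 2 * pi}"

definition carleson_box :: "real set \<Rightarrow> complex set" where
  "carleson_box J = {complex_of_real r * cis \<theta> | r \<theta>.
     \<theta> \<in> J \<and> 1 - measure lborel J / (2 * pi) \<le> r \<and> r < 1}"

definition carleson_measure :: "real \<Rightarrow> complex measure \<Rightarrow> bool" where
  "carleson_measure s \<nu> \<longleftrightarrow>
     (SUP J\<in>arc_angles. emeasure \<nu> (carleson_box J) / ennreal (measure lborel J powr s)) < \<infinity>"

definition measure_on_disc :: "real measure \<Rightarrow> complex measure" where
  "measure_on_disc \<mu> = distr \<mu> (restrict_space borel (ball 0 1)) complex_of_real"

end

theory Submission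
  imports Defs
begin

text \<open>
  For \<open>h\<close> bounded by \<open>A\<close> in the disc put \<open>F w = h w / (1 - w)\<close>, whose Taylor coefficients are the
  partial sums of those of \<open>h\<close>. Cauchy's inequality gives \<open>|F' w| \<le> 4 * A / (1 - |w|)\<^sup>2\<close>, so that
  \<open>(C\<^sub>\<mu> h)' z = \<integral>t. t * F' (t * z) \<partial>\<mu>\<close> is bounded by \<open>4 * A * \<integral>t. 1 / (1 - t * |z|)\<^sup>2 \<partial>\<mu>\<close>, which is
  \<open>O((1 - |z|) powr - \<beta>)\<close> if \<open>\<mu>\<close> is \<open>(2 - \<beta>)\<close>-Carleson. Hence \<open>C\<^sub>\<mu>\<close> maps bounded functions with the
  supremum norm boundedly into the Bloch-type space of order \<open>\<beta>\<close>. For \<open>\<alpha> < 1\<close> the Bloch-type space of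
  order \<open>\<alpha>\<close> embeds compactly into the bounded functions, which yields boundedness and compactness
  at once. Conversely \<open>(C\<^sub>\<mu> 1)' r = \<integral>t. t / (1 - t * r)\<^sup>2 \<partial>\<mu>\<close> dominates \<open>\<mu> [r, 1) / (8 * (1 - r)\<^sup>2)\<close> for
  \<open>r \<ge> 1 / 2\<close>, so the Carleson condition is already forced by the image of the constant \<open>1\<close>.
\<close>

subsection \<open>Bloch-type spaces\<close>

text \<open>Along a radius the derivative is at most \<open>C * (1 - x) powr (- \<alpha>)\<close>,
  which is integrable up to the boundary because \<alpha> < 1. The resulting bound does not involve
  \<open>r\<close> and tends to 0 as \<open>s\<close> approaches 1; this uniform control near the
  circle is what later makes the embedding into bounded functions compact.\<close>

lemma norm_radial_diff_le:
  assumes f: "f holomorphic_on ball 0 1" and \<alpha>: "\<alpha> < 1" and u: "cmod u = 1"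
    and C: "\<And>z. cmod z < 1 \<Longrightarrow> (1 - (cmod z)\<^sup>2) powr \<alpha> * cmod (deriv f z) \<le> C"
    and \<alpha>0: "0 \<le> \<alpha>" and s: "0 \<le> s" "s \<le> r" "r < 1"
  shows "cmod (f (of_real r * u) - f (of_real s * u)) \<le> C / (1 - \<alpha>) * (1 - s) powr (1 - \<alpha>)"
proof -
  define f' where "f' x = u * deriv f (of_real x * u)" for x :: real
  \<comment> \<open>\<open>G\<close> is an antiderivative of the majorant \<open>G'\<close>, chosen
    to vanish at the boundary point 1.\<close>
  define G where "G x = - C / (1 - \<alpha>) * (1 - x) powr (1 - \<alpha>)" for x
  define G' where "G' x = C * (1 - x) powr (- \<alpha>)" for x
  have "C \<ge> 0" using C[of 0] by (simp add: order_trans[OF norm_ge_zero])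
  have f': "(f' has_integral f (of_real r * u) - f (of_real s * u)) {s..r}"
  proof (rule fundamental_theorem_of_calculus[OF s(2)])
    fix x assume "x \<in> {s..r}"
    then have "cmod (of_real x * u) < 1" using s u by (simp add: norm_mult)
    then have "(f has_field_derivative deriv f (of_real x * u)) (at (of_real x * u))"
      using f by (auto intro: holomorphic_derivI)
    moreover have "((\<lambda>x. of_real x * u) has_vector_derivative u) (at x)"
      by (auto intro!: derivative_eq_intros)
    ultimately have "((f \<circ> (\<lambda>x. of_real x * u)) has_vector_derivative f' x) (at x)"
      unfolding f'_def by (intro field_vector_diff_chain_at)
    then show "((\<lambda>x. f (of_real x * u)) has_vector_derivative f' x) (at x within {s..r})"
      by (auto simp: o_def intro: has_vector_derivative_at_within)
  qed
  have G': "(G' has_integral G r - G s) {s..r}"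
  proof (rule fundamental_theorem_of_calculus[OF s(2)])
    fix x assume "x \<in> {s..r}"
    then have "1 - x > 0" using s by simp
    then have "((\<lambda>x. (1 - x) powr (1 - \<alpha>)) has_field_derivative
        (1 - \<alpha>) * (1 - x) powr (1 - \<alpha> - 1) * (0 - 1)) (at x)"
      by (intro DERIV_chain2[where f = "\<lambda>z. z powr (1 - \<alpha>)"] has_real_derivative_powr
          DERIV_diff DERIV_const DERIV_ident)
    from DERIV_cmult[OF this, of "- C / (1 - \<alpha>)"] have "(G has_field_derivative G' x) (at x)"
      using \<alpha> by (simp add: G_def[abs_def] G'_def)
    then show "(G has_vector_derivative G' x) (at x within {s..r})"
      by (auto intro: has_vector_derivative_at_within simp: has_real_derivative_iff_has_vector_derivative)
  qed
  have "cmod (f' x) \<le> G' x" if x: "x \<in> {s..r}" for x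
  proof -
    have x: "0 \<le> x" "x < 1" using x s by auto
    then have "(1 - x\<^sup>2) powr \<alpha> * cmod (deriv f (of_real x * u)) \<le> C"
      using C[of "of_real x * u"] u by (simp add: norm_mult)
    \<comment> \<open>Since x^2 \<le> x on [0,1) and \<alpha> is nonnegative, the weight may be
      replaced by the smaller power of 1 - x.\<close>
    moreover have "(1 - x) powr \<alpha> \<le> (1 - x\<^sup>2) powr \<alpha>"
      using x \<alpha>0 by (intro powr_mono2) (auto simp: power2_eq_square mult_left_le_one_le)
    ultimately have "(1 - x) powr \<alpha> * cmod (deriv f (of_real x * u)) \<le> C"
      by (meson mult_right_mono norm_ge_zero order_trans)
    then show ?thesis
      using x u by (simp add: f'_def G'_def norm_mult powr_minus field_simps)
  qed
  then have "norm (integral {s..r} f') \<le> integral {s..r} G'"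
    using f' G' by (intro Henstock_Kurzweil_Integration.integral_norm_bound_integral) auto
  then have "cmod (f (of_real r * u) - f (of_real s * u)) \<le> G r - G s"
    using f' G' by (simp add: integral_unique)
  \<comment> \<open>\<open>G r\<close> is nonpositive, and dropping it removes the dependence on the
    outer radius.\<close>
  also have "\<dots> \<le> - G s" using \<open>C \<ge> 0\<close> \<alpha> by (simp add: G_def)
  finally show ?thesis by (simp add: G_def)
qed

section \<open>Elementary properties of the Bloch norm\<close>

lemma bloch_space_holomorphic: "f \<in> bloch_space \<alpha> \<Longrightarrow> f holomorphic_on ball 0 1"
  by (simp add: bloch_space_def)

text \<open>Membership supplies the boundedness without which a real \<open>SUP\<close> need not be
  an upper bound.\<close>

lemma bloch_norm_ge:
  assumes "f \<in> bloch_space \<alpha>" "cmod z < 1"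
  shows "cmod (f 0) + (1 - (cmod z)\<^sup>2) powr \<alpha> * cmod (deriv f z) \<le> bloch_norm \<alpha> f"
  using assms unfolding bloch_norm_def bloch_space_def
  by (auto intro!: cSUP_upper2)

lemma bloch_norm_nonneg:
  assumes "f \<in> bloch_space \<alpha>"
  shows "0 \<le> bloch_norm \<alpha> f"
  using bloch_norm_ge[OF assms, of 0]
  by (simp add: order_trans[OF add_nonneg_nonneg[OF norm_ge_zero norm_ge_zero]])

lemma bloch_space_norm_leI:
  assumes "f holomorphic_on ball 0 1"
    and "\<And>z. cmod z < 1 \<Longrightarrow> (1 - (cmod z)\<^sup>2) powr \<alpha> * cmod (deriv f z) \<le> B"
  shows "f \<in> bloch_space \<alpha>" and "bloch_norm \<alpha> f \<le> cmod (f 0) + B"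
proof -
  show "f \<in> bloch_space \<alpha>"
    using assms by (auto simp: bloch_space_def intro!: bdd_aboveI2[where M=B])
  show "bloch_norm \<alpha> f \<le> cmod (f 0) + B"
    unfolding bloch_norm_def using assms(2) by (auto intro!: cSUP_least)
qed

text \<open>The disc is open, so agreement there also determines the derivatives. This is needed
  because linearity of the operator is only available inside the disc.\<close>

lemma bloch_norm_cong:
  assumes "\<And>z. cmod z < 1 \<Longrightarrow> f z = g z"
  shows "bloch_norm \<alpha> f = bloch_norm \<alpha> g"
proof -
  have "deriv f z = deriv g z" if "z \<in> ball 0 1" for z
    using assms eventually_nhds_in_open[OF open_ball that]
    by (intro deriv_cong_ev) (auto elim: eventually_mono)
  then show ?thesis using assms by (simp add: bloch_norm_def)
qed

text \<open>The radial estimate started at the centre, \<open>s = 0\<close>, bounds the distance of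
  \<open>f z\<close> from \<open>f 0\<close>. This is the embedding of the Bloch-type space into the
  bounded functions.\<close>

lemma norm_le_bloch_norm:
  assumes f: "f \<in> bloch_space \<alpha>" and \<alpha>: "0 \<le> \<alpha>" "\<alpha> < 1" and z: "cmod z < 1"
  shows "cmod (f z) \<le> (1 + 1 / (1 - \<alpha>)) * bloch_norm \<alpha> f"
proof -
  have le: "(1 - (cmod z)\<^sup>2) powr \<alpha> * cmod (deriv f z) \<le> bloch_norm \<alpha> f" if "cmod z < 1" for z
    using bloch_norm_ge[OF f that] norm_ge_zero[of "f 0"] by linarith
  have 0: "cmod (f 0) \<le> bloch_norm \<alpha> f"
    using bloch_norm_ge[OF f, of 0] norm_ge_zero[of "deriv f 0"] by (simp del: norm_ge_zero)
  \<comment> \<open>At the origin the direction is arbitrary; 1 keeps \<open>u\<close> on the unit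
    circle.\<close>
  define u where "u = (if z = 0 then 1 else sgn z)"
  have u: "cmod u = 1" "z = of_real (cmod z) * u"
    by (auto simp: u_def norm_sgn) (simp_all add: sgn_eq)
  have "cmod (f z - f 0) \<le> bloch_norm \<alpha> f / (1 - \<alpha>)"
    using norm_radial_diff_le[OF bloch_space_holomorphic[OF f] \<alpha>(2) u(1) le \<alpha>(1), of 0 "cmod z"]
      z u(2) by simp
  then show ?thesis
    using 0 norm_triangle_sub[of "f z" "f 0"] by (simp add: distrib_right)
qed

text \<open>Locally uniform convergence is Montel's theorem; the radial estimate, inherited by the limit,
  controls the remaining annulus uniformly.\<close>

lemma bloch_bounded_uniformly_convergent_subseq:
  assumes \<alpha>: "0 \<le> \<alpha>" "\<alpha> < 1"
    and F: "\<And>n. F n \<in> bloch_space \<alpha>" and C: "\<And>n. bloch_norm \<alpha> (F n) \<le> C"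
  obtains f r where "f holomorphic_on ball 0 1" "strict_mono (r :: nat \<Rightarrow> nat)"
    "uniform_limit (ball 0 1) (\<lambda>n. F (r n)) f sequentially"
    "\<And>z. cmod z < 1 \<Longrightarrow> cmod (f z) \<le> (1 + 1 / (1 - \<alpha>)) * C"
proof -
  have bound: "cmod (F n z) \<le> (1 + 1 / (1 - \<alpha>)) * C" if "cmod z < 1" for n z
    using norm_le_bloch_norm[OF F \<alpha> that, of n] mult_left_mono[OF C, of "1 + 1 / (1 - \<alpha>)" n] \<alpha>
    by simp
  obtain f r where f: "f holomorphic_on ball 0 1" and r: "strict_mono (r :: nat \<Rightarrow> nat)"
    and pw: "\<And>x. x \<in> ball 0 1 \<Longrightarrow> ((\<lambda>n. F (r n) x) \<longlongrightarrow> f x) sequentially"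
    and unif: "\<And>K. \<lbrakk>compact K; K \<subseteq> ball 0 1\<rbrakk> \<Longrightarrow> uniform_limit K (F \<circ> r) f sequentially"
  proof (rule Montel[of "ball 0 1" "range F" F])
    show "\<exists>B. \<forall>h\<in>range F. \<forall>z\<in>K. cmod (h z) \<le> B" if "K \<subseteq> ball 0 1" for K
      using bound that by (intro exI[of _ "(1 + 1 / (1 - \<alpha>)) * C"]) auto
  qed (use bloch_space_holomorphic[OF F] in auto)
  have fbound: "cmod (f z) \<le> (1 + 1 / (1 - \<alpha>)) * C" if "cmod z < 1" for z
    using pw[of z] bound that by (intro tendsto_upperbound[OF tendsto_norm]) auto
  define D where "D = C / (1 - \<alpha>)"
  have "C \<ge> 0" using bloch_norm_nonneg[OF F] C order_trans by blast
  then have "D \<ge> 0" using \<alpha> by (simp add: D_def)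
  have le: "(1 - (cmod z)\<^sup>2) powr \<alpha> * cmod (deriv (F n) z) \<le> C" if "cmod z < 1" for n z
    using bloch_norm_ge[OF F that, of n] norm_ge_zero[of "F n 0"] C[of n] by linarith
  have rad: "cmod (F n (of_real r * u) - F n (of_real s * u)) \<le> D * (1 - s) powr (1 - \<alpha>)"
    if "cmod u = 1" "0 \<le> s" "s \<le> r" "r < 1" for n r s u
    unfolding D_def
    using norm_radial_diff_le[OF bloch_space_holomorphic[OF F] \<alpha>(2) that(1) le \<alpha>(1) that(2-4)] .
  have "uniform_limit (ball 0 1) (\<lambda>n. F (r n)) f sequentially"
    unfolding uniform_limit_iff
  proof (intro allI impI)
    fix e :: real assume e: "e > 0"
    \<comment> \<open>The exponent 1 - \<alpha> is positive, so the radial oscillation beyond radius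
      \<open>s\<close> can be made smaller than e/4, for all members of the sequence at
      once.\<close>
    have "((\<lambda>s. D * (1 - s) powr (1 - \<alpha>)) \<longlongrightarrow> D * (1 - 1) powr (1 - \<alpha>)) (at_left 1)"
      using \<alpha> by (intro tendsto_intros) (auto simp: eventually_at_left_field intro!: exI[of _ 0])
    then have "\<forall>\<^sub>F s in at_left 1. D * (1 - s) powr (1 - \<alpha>) < e / 4"
      using e by (intro order_tendstoD(2)) auto
    moreover have "\<forall>\<^sub>F s in at_left (1::real). 0 < s \<and> s < 1"
      by (auto simp: eventually_at_left_field intro!: exI[of _ 0])
    ultimately have "\<forall>\<^sub>F s in at_left 1. D * (1 - s) powr (1 - \<alpha>) < e / 4 \<and> 0 < s \<and> s < 1"
      by eventually_elim simp
    then obtain s where s: "D * (1 - s) powr (1 - \<alpha>) < e / 4" "0 < s" "s < 1"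
      using eventually_happens'[OF trivial_limit_at_left_real] by blast
    have "uniform_limit (cball 0 s) (F \<circ> r) f sequentially"
      using s by (intro unif) auto
    then have "\<forall>\<^sub>F n in sequentially. \<forall>z\<in>cball 0 s. dist (F (r n) z) (f z) < e / 4"
      unfolding uniform_limit_iff o_def using e by (auto dest: spec[of _ "e / 4"])
    then show "\<forall>\<^sub>F n in sequentially. \<forall>z\<in>ball 0 1. dist (F (r n) z) (f z) < e"
    proof eventually_elim
      case (elim n)
      show ?case
      proof
        fix z :: complex assume "z \<in> ball 0 1"
        then have z: "cmod z < 1" by simp
        show "dist (F (r n) z) (f z) < e"
        proof (cases "cmod z \<le> s")
          case True
          then have "dist (F (r n) z) (f z) < e / 4" using elim by simp
          then show ?thesis using e by simp
        next
          case False
          define u where "u = sgn z"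
          have u: "cmod u = 1" "z = of_real (cmod z) * u"
            using False s by (auto simp: u_def norm_sgn) (simp_all add: sgn_eq)
          \<comment> \<open>\<open>y\<close> is the radial projection of \<open>z\<close> onto the
            circle of radius \<open>s\<close>, where locally uniform convergence applies. Moving
            from \<open>z\<close> to \<open>y\<close> costs at most e/4 for \<open>F (r n)\<close>
            and for \<open>f\<close>, and the difference at \<open>y\<close> is below e/4, which
            leaves a total below e.\<close>
          define y where "y = of_real s * u"
          have y: "cmod y = s" using u s by (simp add: y_def norm_mult)
          have Fd: "cmod (F m z - F m y) \<le> e / 4" for m
            using rad[OF u(1), of s "cmod z" m] False s z u(2) by (simp add: y_def)
          have "(\<lambda>m. F (r m) z - F (r m) y) \<longlonglongrightarrow> f z - f y"
            using z y s by (intro tendsto_diff pw) auto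
          \<comment> \<open>The limit \<open>f\<close> is not known to have a Bloch bound of its
            own; it inherits the radial estimate by pointwise convergence.\<close>
          then have fd: "cmod (f z - f y) \<le> e / 4"
            using Fd by (intro tendsto_upperbound[OF tendsto_norm]) auto
          have "cmod (F (r n) y - f y) < e / 4" using elim y by (simp add: dist_norm)
          moreover have "F (r n) z - f z = (F (r n) z - F (r n) y) + (F (r n) y - f y) - (f z - f y)"
            by simp
          then have "cmod (F (r n) z - f z) \<le>
              cmod (F (r n) z - F (r n) y) + cmod (F (r n) y - f y) + cmod (f z - f y)"
            by (metis add_right_mono norm_triangle_ineq norm_triangle_ineq4 order_trans)
          ultimately show ?thesis using Fd[of "r n"] fd e by (simp add: dist_norm)
        qed
      qed
    qed
  qed
  then show ?thesis using that f r fbound by blast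
qed

subsection \<open>The operator as an integral\<close>

text \<open>Dividing by 1 - w is multiplying by the geometric series, and the Cauchy product with
  that series turns coefficients into their partial sums.\<close>

lemma sums_partial_sums_taylor_coeff:
  assumes "h holomorphic_on ball 0 1" and w: "cmod w < 1"
  shows "(\<lambda>n. (\<Sum>k\<le>n. taylor_coeff h k) * w ^ n) sums (h w / (1 - w))"
proof -
  have taylor: "(\<lambda>n. taylor_coeff h n * v ^ n) sums h v" if "cmod v < 1" for v
    using holomorphic_power_series[OF assms(1), of v] that by (simp add: taylor_coeff_def)
  \<comment> \<open>Convergence at a point of larger modulus, here the midpoint of
    \<open>cmod w\<close> and 1, gives the absolute convergence at \<open>w\<close> that the Cauchy
    product requires.\<close>
  obtain v :: complex where v: "cmod w < cmod v" "cmod v < 1"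
    using that[of "of_real ((1 + cmod w) / 2)"] w by (simp del: of_real_add of_real_divide)
  have "summable (\<lambda>n. norm (taylor_coeff h n * w ^ n))"
    using powser_insidea[OF sums_summable[OF taylor[OF v(2)]] v(1)] .
  moreover have "summable (\<lambda>n. norm (w ^ n))"
    using w by (simp add: norm_power)
  ultimately have "(\<lambda>n. \<Sum>k\<le>n. (taylor_coeff h k * w ^ k) * w ^ (n - k)) sums
      ((\<Sum>n. taylor_coeff h n * w ^ n) * (\<Sum>n. w ^ n))"
    by (rule Cauchy_product_sums)
  also have "(\<Sum>n. taylor_coeff h n * w ^ n) * (\<Sum>n. w ^ n) = h w / (1 - w)"
    using taylor[OF w] geometric_sums[OF w] by (simp add: sums_iff)
  also have "(\<lambda>n. \<Sum>k\<le>n. (taylor_coeff h k * w ^ k) * w ^ (n - k)) =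
      (\<lambda>n. (\<Sum>k\<le>n. taylor_coeff h k) * w ^ n)"
    by (auto simp: sum_distrib_right mult.assoc fun_eq_iff simp flip: power_add intro!: sum.cong)
  finally show ?thesis .
qed

lemma norm_deriv_quotient_le:
  assumes h: "h holomorphic_on ball 0 1" and A: "\<And>w. cmod w < 1 \<Longrightarrow> cmod (h w) \<le> A"
    and w: "cmod w < 1"
  shows "cmod (deriv (\<lambda>w. h w / (1 - w)) w) \<le> 4 * A / (1 - cmod w)\<^sup>2"
proof -
  \<comment> \<open>Half the distance to the circle: on the closed disc of radius \<rho> about
    \<open>w\<close> the denominator still has modulus at least \<rho>, so the quotient is at most
    A/\<rho> and Cauchy's inequality gives A/\<rho>^2.\<close>
  define \<rho> where "\<rho> = (1 - cmod w) / 2"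
  have \<rho>: "\<rho> > 0" using w by (simp add: \<rho>_def)
  have sub: "cmod x \<le> 1 - \<rho>" if "x \<in> cball w \<rho>" for x
  proof -
    have "cmod x \<le> cmod w + dist w x"
      by (metis dist_commute dist_norm norm_triangle_sub)
    then show ?thesis using that by (simp add: \<rho>_def field_simps)
  qed
  have hol: "(\<lambda>w. h w / (1 - w)) holomorphic_on ball 0 1"
    using h by (auto intro!: holomorphic_intros)
  have sub': "cball w \<rho> \<subseteq> ball 0 1"
    using sub \<rho> by fastforce
  have "A \<ge> 0" using A[of 0] norm_ge_zero[of "h 0"] by (simp del: norm_ge_zero)
  have "cmod ((deriv ^^ 1) (\<lambda>w. h w / (1 - w)) w) \<le> fact 1 * (A / \<rho>) / \<rho> ^ 1"
  proof (rule Cauchy_inequality)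
    show "(\<lambda>w. h w / (1 - w)) holomorphic_on ball w \<rho>"
      using hol sub' ball_subset_cball by (blast intro: holomorphic_on_subset)
    show "continuous_on (cball w \<rho>) (\<lambda>w. h w / (1 - w))"
      using hol sub' by (blast intro: holomorphic_on_subset holomorphic_on_imp_continuous_on)
    fix x assume "cmod (w - x) = \<rho>"
    then have x: "cmod x \<le> 1 - \<rho>" using sub[of x] by (simp add: dist_norm)
    have "\<rho> \<le> cmod (1 - x)"
      using x norm_triangle_ineq2[of 1 x] by simp
    then show "cmod (h x / (1 - x)) \<le> A / \<rho>"
      using x \<rho> A[of x] \<open>A \<ge> 0\<close> unfolding norm_divide by (intro frac_le) auto
  qed (fact \<rho>)
  then show ?thesis
    by (simp add: \<rho>_def power2_eq_square)
qed

text \<open>Prescribing the sigma-algebra also fixes the space as [0,1). In particular there is no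
  mass at 1, where 1/(1 - t z) could fail to be controlled near the circle.\<close>

locale unit_interval_measure = finite_measure \<mu> for \<mu> :: "real measure" +
  assumes sets_eq: "sets \<mu> = sets (restrict_space borel {0..<1})"
begin

lemma space_eq: "space \<mu> = {0..<1}"
  using sets_eq_imp_space_eq[OF sets_eq] by (simp add: space_restrict_space)

lemma borel_measurable_if_borel:
  "f \<in> borel_measurable borel \<Longrightarrow> f \<in> borel_measurable \<mu>"
  unfolding measurable_cong_sets[OF sets_eq refl] by (rule measurable_restrict_space1)

lemma integrable_power: "integrable \<mu> (\<lambda>t. t ^ n)"
proof (rule integrable_const_bound[where B=1])
  show "AE t in \<mu>. norm (t ^ n) \<le> 1"
    by (rule AE_I2) (auto simp: space_eq power_le_one)
  show "(\<lambda>t. t ^ n) \<in> borel_measurable \<mu>"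
    by (rule borel_measurable_if_borel) measurable
qed

lemma moment_bounds: "0 \<le> moment \<mu> n" "moment \<mu> n \<le> measure \<mu> (space \<mu>)"
proof -
  show "0 \<le> moment \<mu> n"
    unfolding moment_def by (rule Bochner_Integration.integral_nonneg) (auto simp: space_eq)
  have "moment \<mu> n \<le> (\<integral>t. 1 \<partial>\<mu>)"
    unfolding moment_def
    by (intro Bochner_Integration.integral_mono integrable_power) (simp_all add: space_eq power_le_one)
  then show "moment \<mu> n \<le> measure \<mu> (space \<mu>)"
    by (simp only: lebesgue_integral_const real_scaleR_def mult_1_right)
qed

text \<open>Powers of \<open>t\<close> lie in [0,1] and \<mu> is finite, so absolute summability of
  \<open>d\<close> justifies exchanging sum and integral. The exponents \<open>k\<close> are left
  free: \<open>id\<close> yields the operator itself, \<open>Suc\<close> its derivative.\<close>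

lemma moment_series:
  fixes d :: "nat \<Rightarrow> complex" and k :: "nat \<Rightarrow> nat"
  assumes d: "summable (\<lambda>n. cmod (d n))"
  shows "integrable \<mu> (\<lambda>t. \<Sum>n. of_real (t ^ k n) * d n)"
    and "(\<lambda>n. of_real (moment \<mu> (k n)) * d n) sums (\<integral>t. (\<Sum>n. of_real (t ^ k n) * d n) \<partial>\<mu>)"
proof -
  have int: "integrable \<mu> (\<lambda>t. of_real (t ^ n) * d m)" for n m
    by (intro integrable_mult_left integrable_of_real integrable_power)
  have "(\<integral>t. cmod (of_real (t ^ n) * d m) \<partial>\<mu>) = moment \<mu> n * cmod (d m)" for n m
  proof -
    have "(\<integral>t. cmod (of_real (t ^ n) * d m) \<partial>\<mu>) = (\<integral>t. t ^ n * cmod (d m) \<partial>\<mu>)"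
      by (rule Bochner_Integration.integral_cong) (auto simp: norm_mult space_eq norm_power)
    then show ?thesis by (simp add: moment_def)
  qed
  moreover have "summable (\<lambda>n. moment \<mu> (k n) * cmod (d n))"
  proof (rule summable_comparison_test')
    show "summable (\<lambda>n. measure \<mu> (space \<mu>) * cmod (d n))"
      using d by (rule summable_mult)
    show "norm (moment \<mu> (k n) * cmod (d n)) \<le> measure \<mu> (space \<mu>) * cmod (d n)" for n
      using moment_bounds by (simp add: abs_mult mult_right_mono)
  qed
  ultimately have sum: "summable (\<lambda>n. \<integral>t. cmod (of_real (t ^ k n) * d n) \<partial>\<mu>)"
    by simp
  have AE: "AE t in \<mu>. summable (\<lambda>n. cmod (of_real (t ^ k n) * d n))"
  proof (rule AE_I2, rule summable_comparison_test'[OF d])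
    fix t n assume "t \<in> space \<mu>"
    then have "0 \<le> t ^ k n" "t ^ k n \<le> 1" by (auto simp: space_eq power_le_one)
    then show "norm (cmod (of_real (t ^ k n) * d n)) \<le> cmod (d n)"
      by (simp add: norm_mult mult_left_le_one_le del: of_real_power)
  qed
  show "integrable \<mu> (\<lambda>t. \<Sum>n. of_real (t ^ k n) * d n)"
    by (rule integrable_suminf[OF int AE sum])
  have "(\<lambda>n. \<integral>t. of_real (t ^ k n) * d n \<partial>\<mu>) sums (\<integral>t. (\<Sum>n. of_real (t ^ k n) * d n) \<partial>\<mu>)"
    by (rule sums_integral[OF int AE sum])
  moreover have "(\<integral>t. of_real (t ^ k n) * d n \<partial>\<mu>) = of_real (moment \<mu> (k n)) * d n" for n
    unfolding moment_def
    by (simp only: integral_mult_left_zero integral_complex_of_real)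
  ultimately show "(\<lambda>n. of_real (moment \<mu> (k n)) * d n) sums (\<integral>t. (\<Sum>n. of_real (t ^ k n) * d n) \<partial>\<mu>)"
    by (simp only:)
qed

text \<open>Ensures that the \<open>suminf\<close> defining the operator is the value of a
  convergent series: the moments are bounded and the series of partial sums converges absolutely in
  the disc.\<close>

lemma cesaro_like_sums:
  assumes h: "h holomorphic_on ball 0 1" and z: "cmod z < 1"
  shows "(\<lambda>n. (of_real (moment \<mu> n) * (\<Sum>k\<le>n. taylor_coeff h k)) * z ^ n) sums cesaro_like \<mu> h z"
proof -
  obtain v :: complex where v: "cmod z < cmod v" "cmod v < 1"
    using that[of "of_real ((1 + cmod z) / 2)"] z by (simp del: of_real_add of_real_divide)
  have "summable (\<lambda>n. cmod ((\<Sum>k\<le>n. taylor_coeff h k) * z ^ n))"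
    using powser_insidea[OF sums_summable[OF sums_partial_sums_taylor_coeff[OF h v(2)]] v(1)] .
  from moment_series(2)[OF this, of id] show ?thesis
    unfolding cesaro_like_def by (auto simp: sums_iff mult.assoc)
qed

text \<open>The power series is differentiated term by term, and only then are sum and integral
  exchanged; this avoids differentiating under the integral sign.\<close>

lemma cesaro_like_has_field_derivative:
  assumes h: "h holomorphic_on ball 0 1" and z: "cmod z < 1"
  defines "F \<equiv> \<lambda>w. h w / (1 - w)"
  shows "integrable \<mu> (\<lambda>t. of_real t * deriv F (of_real t * z))" (is ?int)
    and "(cesaro_like \<mu> h has_field_derivative
           (\<integral>t. of_real t * deriv F (of_real t * z) \<partial>\<mu>)) (at z)" (is ?deriv)
proof -
  define b where "b = (\<lambda>n. \<Sum>k\<le>n. taylor_coeff h k)"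
  define c where "c = (\<lambda>n. of_real (moment \<mu> n) * b n)"
  have F: "(\<lambda>n. b n * w ^ n) sums F w" if "cmod w < 1" for w
    using sums_partial_sums_taylor_coeff[OF h that] by (simp add: b_def F_def)
  have "F holomorphic_on ball 0 1"
    unfolding F_def using h by (auto intro!: holomorphic_intros)
  then have F': "(\<lambda>n. diffs b n * w ^ n) sums deriv F w" if "cmod w < 1" for w
    using that by (intro termdiffs_sums_strong[where K=1 and f=F] F)
      (auto intro: holomorphic_derivI)
  obtain v :: complex where v: "cmod z < cmod v" "cmod v < 1"
    using that[of "of_real ((1 + cmod z) / 2)"] z by (simp del: of_real_add of_real_divide)
  have abs: "summable (\<lambda>n. cmod (diffs b n * z ^ n))"
    using powser_insidea[OF sums_summable[OF F'[OF v(2)]] v(1)] .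
  have eq: "(\<Sum>n. of_real (t ^ Suc n) * (diffs b n * z ^ n)) = of_real t * deriv F (of_real t * z)"
    if t: "t \<in> space \<mu>" for t
  proof -
    have t': "0 \<le> t" "t < 1" using t by (auto simp: space_eq)
    then have "cmod (of_real t * z) < 1"
      using mult_mono[of t 1 "cmod z" "cmod z"] z by (simp add: norm_mult)
    from sums_mult[OF F'[OF this], of "of_real t"] show ?thesis
      by (simp add: sums_iff power_mult_distrib mult_ac)
  qed
  show ?int
    using moment_series(1)[OF abs, of Suc] Bochner_Integration.integrable_cong[OF refl eq]
    by (rule iffD1[rotated]) simp
  \<comment> \<open>Differentiation shifts the index, so the n-th coefficient carries the moment of
    order n + 1; its power \<open>t ^ Suc n\<close> accounts for the extra factor \<open>t\<close>
    in the integrand.\<close>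
  have c: "diffs c n * z ^ n = of_real (moment \<mu> (Suc n)) * (diffs b n * z ^ n)" for n
    by (simp add: diffs_def c_def)
  have "(\<Sum>n. diffs c n * z ^ n) = (\<integral>t. (\<Sum>n. of_real (t ^ Suc n) * (diffs b n * z ^ n)) \<partial>\<mu>)"
    unfolding c using moment_series(2)[OF abs, of Suc] by (simp add: sums_iff)
  also have "\<dots> = (\<integral>t. of_real t * deriv F (of_real t * z) \<partial>\<mu>)"
    by (rule Bochner_Integration.integral_cong[OF refl eq])
  moreover have "((\<lambda>z. \<Sum>n. c n * z ^ n) has_field_derivative (\<Sum>n. diffs c n * z ^ n)) (at z)"
    using cesaro_like_sums[OF h] z
    by (intro termdiffs_strong'[where K=1]) (auto simp: c_def b_def sums_iff)
  moreover have "(\<lambda>z. \<Sum>n. c n * z ^ n) = cesaro_like \<mu> h"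
    by (simp add: cesaro_like_def c_def b_def fun_eq_iff)
  ultimately show ?deriv by simp
qed

lemma cesaro_like_holomorphic:
  assumes "h holomorphic_on ball 0 1"
  shows "cesaro_like \<mu> h holomorphic_on ball 0 1"
  using cesaro_like_has_field_derivative(2)[OF assms]
  unfolding holomorphic_on_open[OF open_ball] by (metis mem_ball_0)

lemma cesaro_like_0: "cesaro_like \<mu> h 0 = of_real (measure \<mu> (space \<mu>)) * h 0"
proof -
  have "(\<lambda>n. (of_real (moment \<mu> n) * (\<Sum>k\<le>n. taylor_coeff h k)) * 0 ^ n) sums
      (of_real (moment \<mu> 0) * (\<Sum>k\<le>0. taylor_coeff h k))"
    by (rule powser_sums_zero)
  then show ?thesis
    by (simp add: cesaro_like_def sums_iff taylor_coeff_def moment_def)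
qed

lemma cesaro_like_diff:
  assumes f: "f holomorphic_on ball 0 1" and g: "g holomorphic_on ball 0 1" and z: "cmod z < 1"
  shows "cesaro_like \<mu> (\<lambda>w. f w - g w) z = cesaro_like \<mu> f z - cesaro_like \<mu> g z"
proof -
  have "taylor_coeff (\<lambda>w. f w - g w) k = taylor_coeff f k - taylor_coeff g k" for k
    using higher_deriv_diff[OF f g, of 0 k] by (simp add: taylor_coeff_def diff_divide_distrib)
  then have "taylor_coeff (\<lambda>w. f w - g w) = (\<lambda>k. taylor_coeff f k - taylor_coeff g k)"
    by blast
  then have "(\<lambda>n. (of_real (moment \<mu> n) * (\<Sum>k\<le>n. taylor_coeff f k)) * z ^ n -
      (of_real (moment \<mu> n) * (\<Sum>k\<le>n. taylor_coeff g k)) * z ^ n) =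
     (\<lambda>n. (of_real (moment \<mu> n) * (\<Sum>k\<le>n. taylor_coeff (\<lambda>w. f w - g w) k)) * z ^ n)"
    by (simp add: sum_subtractf algebra_simps)
  then show ?thesis
    using sums_unique2 sums_diff[OF cesaro_like_sums[OF f z] cesaro_like_sums[OF g z]]
      cesaro_like_sums[OF holomorphic_on_diff[OF f g] z] by metis
qed

section \<open>The kernel and the derivative of the image\<close>

lemma measurable_kernel: "(\<lambda>t. 1 / (1 - t * r)\<^sup>2) \<in> borel_measurable \<mu>"
  by (rule borel_measurable_if_borel) measurable

lemma kernel_le:
  assumes "t \<in> space \<mu>" "0 \<le> r" "r < 1"
  shows "1 / (1 - t * r)\<^sup>2 \<le> 1 / (1 - r)\<^sup>2"
proof -
  have "t * r \<le> r" using assms by (auto simp: space_eq mult_left_le_one_le)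
  then show ?thesis using assms by (intro divide_left_mono power_mono) (auto simp: power2_eq_square intro!: mult_pos_pos)
qed

lemma integrable_kernel:
  assumes "0 \<le> r" "r < 1"
  shows "integrable \<mu> (\<lambda>t. 1 / (1 - t * r)\<^sup>2)"
  using kernel_le[OF _ assms]
  by (intro integrable_const_bound[where B = "1 / (1 - r)\<^sup>2"] measurable_kernel AE_I2) simp

text \<open>Applies the Cauchy estimate for the quotient at each point t z under the integral; the
  outer factor \<open>t\<close> is at most 1.\<close>

lemma norm_deriv_cesaro_like_le:
  assumes h: "h holomorphic_on ball 0 1" and A: "\<And>w. cmod w < 1 \<Longrightarrow> cmod (h w) \<le> A"
    and z: "cmod z < 1"
  shows "cmod (deriv (cesaro_like \<mu> h) z) \<le> 4 * A * (\<integral>t. 1 / (1 - t * cmod z)\<^sup>2 \<partial>\<mu>)"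
proof -
  let ?F = "\<lambda>w. h w / (1 - w)"
  have "cmod (of_real t * deriv ?F (of_real t * z)) \<le> 4 * A * (1 / (1 - t * cmod z)\<^sup>2)"
    if t: "t \<in> space \<mu>" for t
  proof -
    have t: "0 \<le> t" "t < 1" using t by (auto simp: space_eq)
    then have eq: "cmod (of_real t * z) = t * cmod z" by (simp add: norm_mult)
    have "t * cmod z < 1" using t z mult_mono[of t 1 "cmod z" "cmod z"] by simp
    then have "cmod (deriv ?F (of_real t * z)) \<le> 4 * A / (1 - t * cmod z)\<^sup>2"
      using norm_deriv_quotient_le[OF h A, of "of_real t * z"] by (simp add: eq)
    moreover have "cmod (of_real t * deriv ?F (of_real t * z)) \<le> cmod (deriv ?F (of_real t * z))"
      using t by (simp add: norm_mult mult_left_le_one_le)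
    ultimately show ?thesis by simp
  qed
  then have "cmod (\<integral>t. of_real t * deriv ?F (of_real t * z) \<partial>\<mu>) \<le>
      (\<integral>t. 4 * A * (1 / (1 - t * cmod z)\<^sup>2) \<partial>\<mu>)"
    by (intro Bochner_Integration.integral_norm_bound_integral
        cesaro_like_has_field_derivative[OF h z] integrable_mult_right integrable_kernel z) auto
  also have "\<dots> = 4 * A * (\<integral>t. 1 / (1 - t * cmod z)\<^sup>2 \<partial>\<mu>)"
    by (rule integral_mult_right_zero)
  finally show ?thesis
    using DERIV_imp_deriv[OF cesaro_like_has_field_derivative(2)[OF h z]] by simp
qed

subsection \<open>The Carleson condition and the kernel estimate\<close>

lemma sets_iff: "A \<in> sets \<mu> \<longleftrightarrow> A \<subseteq> {0..<1} \<and> A \<in> sets borel"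
  unfolding sets_eq by (rule sets_restrict_space_iff) simp

text \<open>Dyadic decomposition at the scale \<open>\<delta> = 1 - r\<close>: the kernel is dominated by
  \<open>4 / (2 ^ k * \<delta>)\<^sup>2\<close> on the tail \<open>t \<ge> 1 - 2 ^ k * \<delta>\<close> for the least \<open>k\<close> such that \<open>t\<close> lies in it.\<close>

lemma integral_kernel_le:
  assumes \<beta>: "0 < \<beta>" "\<beta> < 2"
    and M: "\<And>t. 0 \<le> t \<Longrightarrow> t < 1 \<Longrightarrow> measure \<mu> {t..<1} \<le> M * (1 - t) powr (2 - \<beta>)"
    and r: "0 \<le> r" "r < 1"
  shows "(\<integral>t. 1 / (1 - t * r)\<^sup>2 \<partial>\<mu>) \<le> 4 * M / (1 - 2 powr - \<beta>) * (1 - r) powr - \<beta>"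
proof -
  define \<delta> where "\<delta> = 1 - r"
  have \<delta>: "\<delta> > 0" using r by (simp add: \<delta>_def)
  define E where "E k = {t \<in> space \<mu>. 1 - 2 ^ k * \<delta> \<le> t}" for k
  define a where "a k = 4 / (2 ^ k * \<delta>)\<^sup>2" for k
  have a0: "0 \<le> a k" for k by (simp add: a_def)
  define q :: real where "q = 2 powr - \<beta>"
  have q: "0 < q" "q < 1" using \<beta> by (auto simp: q_def powr_less_one)
  \<comment> \<open>The tail at t = 0 is the whole space.\<close>
  have M0: "0 \<le> M" "measure \<mu> (space \<mu>) \<le> M"
    using M[of 0] measure_nonneg[of \<mu> "{0..<1}"] by (auto simp: space_eq simp del: measure_nonneg)
  have E_sets: "E k \<in> sets \<mu>" for k
  proof -
    have "E k = {0..<1} \<inter> {1 - 2 ^ k * \<delta>..}" by (auto simp: E_def space_eq)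
    then show ?thesis by (simp add: sets_iff)
  qed
  have E: "measure \<mu> (E k) \<le> M * (2 ^ k * \<delta>) powr (2 - \<beta>)" for k
  proof (cases "2 ^ k * \<delta> \<le> 1")
    case True
    then have "E k = {1 - 2 ^ k * \<delta>..<1}" by (auto simp: E_def space_eq)
    then show ?thesis using M[of "1 - 2 ^ k * \<delta>"] True \<delta> by simp
  next
    case False
    \<comment> \<open>Beyond scale 1 the total mass suffices, because the power of a number above 1
      with exponent 2 - \<beta> > 0 is at least 1.\<close>
    have "measure \<mu> (E k) \<le> measure \<mu> (space \<mu>)" by (rule bounded_measure)
    also have "\<dots> \<le> M * 1" using M0 by simp
    also have "\<dots> \<le> M * (2 ^ k * \<delta>) powr (2 - \<beta>)"
      using False \<beta> M0 by (intro mult_left_mono ge_one_powr_ge_zero) auto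
    finally show ?thesis .
  qed
  \<comment> \<open>The factor 4/x^2 against the tail bound x^(2 - \<beta>) leaves x^(-\<beta>),
    which is geometric in \<open>k\<close> with ratio \<open>q\<close> < 1 because \<beta> >
    0.\<close>
  have dyadic: "a k * measure \<mu> (E k) \<le> 4 * M * \<delta> powr - \<beta> * q ^ k" for k
  proof -
    define x where "x = 2 ^ k * \<delta>"
    have x: "x > 0" using \<delta> by (simp add: x_def)
    have "a k * measure \<mu> (E k) \<le> 4 / x\<^sup>2 * (M * x powr (2 - \<beta>))"
      unfolding a_def x_def by (intro mult_left_mono E) auto
    also have "\<dots> = 4 * M * x powr - \<beta>"
      using x by (simp add: powr_diff powr_minus divide_simps)
    also have "x powr - \<beta> = \<delta> powr - \<beta> * q ^ k"
      using \<delta> by (simp add: x_def q_def powr_mult powr_power mult.commute flip: powr_realpow) (simp add: powr_powr mult.commute)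
    finally show ?thesis by (simp add: mult_ac)
  qed
  have pointwise: "ennreal (1 / (1 - t * r)\<^sup>2) \<le> (\<Sum>k. ennreal (a k) * indicator (E k) t)"
    if t: "t \<in> space \<mu>" for t
  proof -
    have t': "0 \<le> t" "t < 1" using t by (auto simp: space_eq)
    have kern: "1 - t \<le> 1 - t * r" "\<delta> \<le> 1 - t * r"
      using t' r mult_left_le[of r t] mult_left_le_one_le[of r t] by (auto simp: \<delta>_def)
    obtain n where "1 / \<delta> < 2 ^ n" using real_arch_pow[of 2 "1 / \<delta>"] by auto
    then have n: "1 - t \<le> 2 ^ n * \<delta>" using \<delta> t' by (simp add: field_simps)
    define k where "k = (LEAST k. 1 - t \<le> 2 ^ k * \<delta>)"
    have k: "1 - t \<le> 2 ^ k * \<delta>" unfolding k_def using n by (rule LeastI)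
    \<comment> \<open>For k = 0 this follows from \<delta> \<le> 1 - t r; for k = j + 1 minimality
      gives 1 - t > 2^j \<delta>, which is half of 2^k \<delta>.\<close>
    have "2 ^ k * \<delta> / 2 \<le> 1 - t * r"
    proof (cases k)
      case 0
      then show ?thesis using kern \<delta> by simp
    next
      case (Suc j)
      then have "\<not> 1 - t \<le> 2 ^ j * \<delta>" unfolding k_def using not_less_Least by (metis lessI)
      then show ?thesis using kern Suc by simp
    qed
    moreover have "0 < 2 ^ k * \<delta> / 2" using \<delta> by simp
    ultimately have "1 / (1 - t * r)\<^sup>2 \<le> 1 / (2 ^ k * \<delta> / 2)\<^sup>2"
      by (meson frac_le order_refl power_mono zero_le_one zero_less_power order.strict_implies_order)
    also have "\<dots> = a k" by (simp add: a_def power_divide)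
    finally have "ennreal (1 / (1 - t * r)\<^sup>2) \<le> ennreal (a k) * indicator (E k) t"
      using t k by (simp add: E_def ennreal_leI)
    also have "g k \<le> (\<Sum>k. g k)" for g :: "nat \<Rightarrow> ennreal"
      using sum_le_suminf[of g "{k}"] by simp
    finally show ?thesis .
  qed
  \<comment> \<open>With nonnegative extended reals the sum and the integral can be exchanged before
    any summability is established.\<close>
  have "ennreal (\<integral>t. 1 / (1 - t * r)\<^sup>2 \<partial>\<mu>) = (\<integral>\<^sup>+t. ennreal (1 / (1 - t * r)\<^sup>2) \<partial>\<mu>)"
    using integrable_kernel[OF r] by (intro nn_integral_eq_integral[symmetric]) auto
  also have "\<dots> \<le> (\<integral>\<^sup>+t. (\<Sum>k. ennreal (a k) * indicator (E k) t) \<partial>\<mu>)"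
    by (intro nn_integral_mono pointwise)
  also have "\<dots> = (\<Sum>k. \<integral>\<^sup>+t. ennreal (a k) * indicator (E k) t \<partial>\<mu>)"
    by (intro nn_integral_suminf borel_measurable_times_ennreal borel_measurable_const
        borel_measurable_indicator E_sets)
  also have "\<dots> = (\<Sum>k. ennreal (a k * measure \<mu> (E k)))"
    using E_sets by (simp add: nn_integral_cmult_indicator emeasure_eq_measure ennreal_mult a0)
  also have "\<dots> \<le> (\<Sum>k. ennreal (4 * M * \<delta> powr - \<beta> * q ^ k))"
    by (intro suminf_le ennreal_leI dyadic) auto
  also have "\<dots> = ennreal (\<Sum>k. 4 * M * \<delta> powr - \<beta> * q ^ k)"
    using q M0 by (intro suminf_ennreal2) (auto intro!: summable_mult summable_geometric)
  also have "(\<Sum>k. 4 * M * \<delta> powr - \<beta> * q ^ k) = 4 * M * \<delta> powr - \<beta> * (1 / (1 - q))"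
    using q geometric_sums[of q] by (subst suminf_mult) (auto intro!: summable_geometric simp: sums_iff)
  finally have "(\<integral>t. 1 / (1 - t * r)\<^sup>2 \<partial>\<mu>) \<le> 4 * M * \<delta> powr - \<beta> * (1 / (1 - q))"
    using q M0 by (subst (asm) ennreal_le_iff) auto
  then show ?thesis by (simp add: \<delta>_def q_def)
qed

section \<open>Carleson boxes and tails of the measure\<close>

lemma measurable_of_real_disc: "complex_of_real \<in> measurable \<mu> (restrict_space borel (ball 0 1))"
  by (rule measurable_restrict_space2)
    (auto simp: space_eq intro: borel_measurable_if_borel)

text \<open>Comparing moduli shows that a box meets [0,1) at most in the tail starting at its inner
  radius, whatever its angles are. The case split replaces a measurability proof for general boxes:
  a set outside the sigma-algebra has \<open>emeasure\<close> 0.\<close>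

lemma emeasure_carleson_box_le:
  assumes J: "J \<in> arc_angles"
  shows "emeasure (measure_on_disc \<mu>) (carleson_box J) \<le>
    ennreal (measure \<mu> {1 - measure lborel J / (2 * pi)..<1})"
proof (cases "carleson_box J \<in> sets (restrict_space borel (ball 0 1))")
  case True
  let ?t = "1 - measure lborel J / (2 * pi)"
  have t: "0 \<le> ?t" "?t < 1" using J by (auto simp: arc_angles_def field_simps)
  have "of_real -` carleson_box J \<inter> space \<mu> \<subseteq> {?t..<1}"
  proof
    fix x assume "x \<in> of_real -` carleson_box J \<inter> space \<mu>"
    then obtain r \<theta> where x: "complex_of_real x = of_real r * cis \<theta>" "?t \<le> r" "r < 1" "0 \<le> x"
      by (auto simp: carleson_box_def space_eq)
    have "\<bar>x\<bar> = \<bar>r\<bar>"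
      using arg_cong[OF x(1), of cmod] by (simp add: norm_mult)
    \<comment> \<open>The inner radius is nonnegative because the arc has length at most 2 pi, which
      rules out r = -x.\<close>
    then have "x = r" using x(2,4) t by linarith
    then show "x \<in> {?t..<1}" using x by simp
  qed
  then have "emeasure \<mu> (of_real -` carleson_box J \<inter> space \<mu>) \<le> emeasure \<mu> {?t..<1}"
    using t by (intro emeasure_mono) (auto simp: sets_iff)
  then show ?thesis
    unfolding measure_on_disc_def emeasure_distr[OF measurable_of_real_disc True]
    by (simp add: emeasure_eq_measure)
next
  case False
  then show ?thesis
    by (simp add: emeasure_notin_sets measure_on_disc_def)
qed

text \<open>The arc is centred at angle 0 with length 2 pi (1 - t), so its box has inner radius
  exactly \<open>t\<close> and contains the segment [t,1). For a lower bound the box must be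
  measurable; it is a countable union of compact sets.\<close>

lemma emeasure_carleson_box_ge:
  assumes t: "0 \<le> t" "t < 1"
  defines "J \<equiv> {- pi * (1 - t)..pi * (1 - t)}"
  shows "ennreal (measure \<mu> {t..<1}) \<le> emeasure (measure_on_disc \<mu>) (carleson_box J)"
proof -
  let ?f = "\<lambda>(r, \<theta>). complex_of_real r * cis \<theta>"
  have J: "1 - measure lborel J / (2 * pi) = t"
    using t by (simp add: J_def field_simps)
  \<comment> \<open>Only the outer radius is excluded from the box, so closed radial intervals
    exhaust it, and each piece is a continuous image of a compact rectangle.\<close>
  have "{t..<1} = (\<Union>n::nat. {t..1 - inverse (of_nat (Suc n))})"
  proof (intro equalityI subsetI)
    fix x assume "x \<in> {t..<1}"
    moreover then obtain n where "inverse (of_nat (Suc n)) < 1 - x"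
      using reals_Archimedean[of "1 - x"] by auto
    ultimately show "x \<in> (\<Union>n::nat. {t..1 - inverse (of_nat (Suc n))})"
      by (auto intro!: exI[of _ n])
  next
    fix x assume "x \<in> (\<Union>n::nat. {t..1 - inverse (of_nat (Suc n))})"
    then obtain n where "t \<le> x" "x \<le> 1 - inverse (of_nat (Suc n))" by auto
    moreover have "inverse (real (Suc n)) > 0" by simp
    ultimately show "x \<in> {t..<1}" unfolding atLeastLessThan_iff by linarith
  qed
  then have "{t..<1} \<times> J = (\<Union>n::nat. {t..1 - inverse (of_nat (Suc n))} \<times> J)"
    by (simp only: Sigma_Union UN_simps)
  moreover have "carleson_box J = ?f ` ({t..<1} \<times> J)"
    unfolding carleson_box_def J by force
  ultimately have "carleson_box J = (\<Union>n::nat. ?f ` ({t..1 - inverse (of_nat (Suc n))} \<times> J))"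
    by (simp only: image_UN)
  moreover have "compact (?f ` ({t..1 - inverse (of_nat (Suc n))} \<times> J))" for n
  proof (rule compact_continuous_image)
    show "continuous_on ({t..1 - inverse (of_nat (Suc n))} \<times> J) ?f"
      unfolding case_prod_beta cis_conv_exp by (intro continuous_intros)
    show "compact ({t..1 - inverse (of_nat (Suc n))} \<times> J)"
      unfolding J_def by (intro compact_Times compact_Icc)
  qed
  ultimately have "carleson_box J \<in> sets borel"
    by (simp only:) (intro sets.countable_UN image_subsetI borel_closed compact_imp_closed)
  moreover have "carleson_box J \<subseteq> ball 0 1"
    unfolding carleson_box_def J using t by (auto simp: norm_mult)
  ultimately have box: "carleson_box J \<in> sets (restrict_space borel (ball 0 1))"
    by (subst sets_restrict_space_iff) auto
  have "{t..<1} \<subseteq> of_real -` carleson_box J \<inter> space \<mu>"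
  proof
    fix x assume x: "x \<in> {t..<1}"
    have "complex_of_real x = of_real x * cis 0" "0 \<in> J" using t by (auto simp: J_def)
    then have "of_real x \<in> carleson_box J"
      unfolding carleson_box_def J mem_Collect_eq using x atLeastLessThan_iff by blast
    then show "x \<in> of_real -` carleson_box J \<inter> space \<mu>" using x t by (auto simp: space_eq)
  qed
  then have "emeasure \<mu> {t..<1} \<le> emeasure \<mu> (of_real -` carleson_box J \<inter> space \<mu>)"
    by (intro emeasure_mono measurable_sets[OF measurable_of_real_disc box])
  then show ?thesis
    unfolding measure_on_disc_def emeasure_distr[OF measurable_of_real_disc box]
    by (simp add: emeasure_eq_measure)
qed

text \<open>An arc of length h corresponds to the tail with 1 - t = h/(2 pi), so the two constants
  differ by the factor (2 pi)^s.\<close>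

lemma carleson_measure_iff:
  "carleson_measure s (measure_on_disc \<mu>) \<longleftrightarrow>
     (\<exists>M. \<forall>t. 0 \<le> t \<longrightarrow> t < 1 \<longrightarrow> measure \<mu> {t..<1} \<le> M * (1 - t) powr s)" (is "?L \<longleftrightarrow> ?R")
proof
  assume ?L
  define S where "S = (SUP J\<in>arc_angles. emeasure (measure_on_disc \<mu>) (carleson_box J) /
      ennreal (measure lborel J powr s))"
  have "S < \<infinity>" using \<open>?L\<close> by (simp add: carleson_measure_def S_def)
  then obtain C where "C \<ge> 0" and C: "S = ennreal C"
    by (cases S) auto
  show ?R
  proof (intro exI allI impI)
    fix t :: real assume t: "0 \<le> t" "t < 1"
    define J where "J = {- pi * (1 - t)..pi * (1 - t)}"
    have len: "measure lborel J = 2 * pi * (1 - t)" using t by (simp add: J_def)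
    have J: "J \<in> arc_angles"
      unfolding arc_angles_def mem_Collect_eq len using t by (simp add: J_def is_interval_cc)
    have "ennreal (measure \<mu> {t..<1} / measure lborel J powr s) =
        ennreal (measure \<mu> {t..<1}) / ennreal (measure lborel J powr s)"
      using t by (intro divide_ennreal[symmetric]) (auto simp: len)
    also have "\<dots> \<le> emeasure (measure_on_disc \<mu>) (carleson_box J) / ennreal (measure lborel J powr s)"
      unfolding J_def by (intro divide_right_mono_ennreal emeasure_carleson_box_ge t)
    also have "\<dots> \<le> ennreal C"
      unfolding C[symmetric] S_def by (rule SUP_upper[OF J])
    finally have "measure \<mu> {t..<1} / measure lborel J powr s \<le> C"
      using \<open>C \<ge> 0\<close> by simp
    then have "measure \<mu> {t..<1} \<le> C * measure lborel J powr s"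
      using t by (simp add: len divide_le_eq)
    moreover have "measure lborel J powr s = (2 * pi) powr s * (1 - t) powr s"
      unfolding len by (rule powr_mult)
    ultimately show "measure \<mu> {t..<1} \<le> C * (2 * pi) powr s * (1 - t) powr s"
      by (simp only: mult.assoc)
  qed
next
  assume ?R
  then obtain M where M: "\<And>t. 0 \<le> t \<Longrightarrow> t < 1 \<Longrightarrow> measure \<mu> {t..<1} \<le> M * (1 - t) powr s"
    by blast
  have "emeasure (measure_on_disc \<mu>) (carleson_box J) / ennreal (measure lborel J powr s) \<le>
      ennreal (M / (2 * pi) powr s)" if J: "J \<in> arc_angles" for J
  proof -
    let ?h = "measure lborel J"
    have h: "0 < ?h" "?h \<le> 2 * pi" using J by (auto simp: arc_angles_def)
    have "emeasure (measure_on_disc \<mu>) (carleson_box J) / ennreal (?h powr s) \<le>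
        ennreal (measure \<mu> {1 - ?h / (2 * pi)..<1}) / ennreal (?h powr s)"
      by (intro divide_right_mono_ennreal emeasure_carleson_box_le J)
    also have "\<dots> = ennreal (measure \<mu> {1 - ?h / (2 * pi)..<1} / ?h powr s)"
      using h by (intro divide_ennreal) auto
    also have "\<dots> \<le> ennreal (M * (?h / (2 * pi)) powr s / ?h powr s)"
      using M[of "1 - ?h / (2 * pi)"] h by (intro ennreal_leI divide_right_mono) (auto simp: field_simps)
    also have "M * (?h / (2 * pi)) powr s / ?h powr s = M / (2 * pi) powr s"
      using h by (simp add: powr_divide)
    finally show ?thesis .
  qed
  then have "(SUP J\<in>arc_angles. emeasure (measure_on_disc \<mu>) (carleson_box J) /
      ennreal (measure lborel J powr s)) \<le> ennreal (M / (2 * pi) powr s)"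
    by (rule SUP_least)
  then show ?L
    unfolding carleson_measure_def infinity_ennreal_def
    using ennreal_less_top by (rule le_less_trans)
qed

subsection \<open>Operators on Bloch-type spaces\<close>

text \<open>The weight of order \<beta> cancels the growth (1 - |z|)^(-\<beta>) of the kernel
  integral. The bound is in terms of the supremum of \<open>h\<close>, so one constant serves the
  images of Bloch functions and also their differences from a uniform limit.\<close>

lemma bloch_norm_cesaro_like_le:
  assumes \<beta>: "0 < \<beta>" "\<beta> < 2"
    and M: "\<And>t. 0 \<le> t \<Longrightarrow> t < 1 \<Longrightarrow> measure \<mu> {t..<1} \<le> M * (1 - t) powr (2 - \<beta>)"
  obtains K where "K \<ge> 0"
    "\<And>h A. h holomorphic_on ball 0 1 \<Longrightarrow> (\<And>w. cmod w < 1 \<Longrightarrow> cmod (h w) \<le> A) \<Longrightarrow>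
      cesaro_like \<mu> h \<in> bloch_space \<beta> \<and> bloch_norm \<beta> (cesaro_like \<mu> h) \<le> K * A"
proof
  define L where "L = 4 * M / (1 - 2 powr - \<beta>)"
  \<comment> \<open>The first summand bounds the value at 0, the second the weighted derivative;
    2^\<beta> comes from 1 - |z|^2 \<le> 2 (1 - |z|).\<close>
  define K where "K = measure \<mu> (space \<mu>) + 2 powr \<beta> * (4 * L)"
  have "0 \<le> M" using M[of 0] measure_nonneg[of \<mu> "{0..<1}"] by (simp del: measure_nonneg)
  moreover have "2 powr - \<beta> < 1" using \<beta> by (simp add: powr_less_one)
  ultimately have "0 \<le> L" by (simp add: L_def)
  then show "0 \<le> K" by (simp add: K_def)
  fix h A assume h: "h holomorphic_on ball 0 1" and A: "\<And>w. cmod w < 1 \<Longrightarrow> cmod (h w) \<le> A"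
  have "0 \<le> A" using A[of 0] norm_ge_zero[of "h 0"] by (simp del: norm_ge_zero)
  have bound: "(1 - (cmod z)\<^sup>2) powr \<beta> * cmod (deriv (cesaro_like \<mu> h) z) \<le> 2 powr \<beta> * (4 * L) * A"
    if z: "cmod z < 1" for z
  proof -
    let ?r = "cmod z"
    have "1 - ?r\<^sup>2 = (1 + ?r) * (1 - ?r)" by (simp add: power2_eq_square algebra_simps)
    also have "\<dots> \<le> 2 * (1 - ?r)" using z by (intro mult_right_mono) auto
    finally have "(1 - ?r\<^sup>2) powr \<beta> \<le> (2 * (1 - ?r)) powr \<beta>"
      using z \<beta> by (intro powr_mono2) (auto simp: power_le_one)
    also have "\<dots> = 2 powr \<beta> * (1 - ?r) powr \<beta>" by (rule powr_mult)
    finally have weight: "(1 - ?r\<^sup>2) powr \<beta> \<le> 2 powr \<beta> * (1 - ?r) powr \<beta>" .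
    have "cmod (deriv (cesaro_like \<mu> h) z) \<le> 4 * A * (\<integral>t. 1 / (1 - t * ?r)\<^sup>2 \<partial>\<mu>)"
      by (rule norm_deriv_cesaro_like_le[OF h A z])
    also have "\<dots> \<le> 4 * A * (L * (1 - ?r) powr - \<beta>)"
      using integral_kernel_le[OF \<beta> M, of ?r] z \<open>0 \<le> A\<close> by (intro mult_left_mono) (auto simp: L_def)
    finally have "(1 - ?r\<^sup>2) powr \<beta> * cmod (deriv (cesaro_like \<mu> h) z) \<le>
        (2 powr \<beta> * (1 - ?r) powr \<beta>) * (4 * A * (L * (1 - ?r) powr - \<beta>))"
      by (intro mult_mono weight) auto
    also have "\<dots> = 2 powr \<beta> * (4 * L) * A * ((1 - ?r) powr \<beta> * (1 - ?r) powr - \<beta>)"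
      by (simp only: mult_ac)
    also have "(1 - ?r) powr \<beta> * (1 - ?r) powr - \<beta> = 1"
      using z by (simp flip: powr_add)
    finally show ?thesis by simp
  qed
  have "cmod (cesaro_like \<mu> h 0) \<le> measure \<mu> (space \<mu>) * A"
    using A[of 0] by (simp add: cesaro_like_0 norm_mult mult_left_mono)
  then have "bloch_norm \<beta> (cesaro_like \<mu> h) \<le> K * A"
    using bloch_space_norm_leI(2)[OF cesaro_like_holomorphic[OF h] bound]
    unfolding K_def distrib_right by linarith
  then show "cesaro_like \<mu> h \<in> bloch_space \<beta> \<and> bloch_norm \<beta> (cesaro_like \<mu> h) \<le> K * A"
    using bloch_space_norm_leI(1)[OF cesaro_like_holomorphic[OF h] bound] by blast
qed

text \<open>Here the quotient is 1/(1 - w), and at real points the integrand is nonnegative. There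
  is no cancellation, so the derivative can be bounded from below.\<close>

lemma deriv_cesaro_like_one:
  assumes r: "0 \<le> r" "r < 1"
  shows "deriv (cesaro_like \<mu> (\<lambda>w. 1)) (of_real r) = of_real (\<integral>t. t * (1 / (1 - t * r)\<^sup>2) \<partial>\<mu>)"
proof -
  let ?F = "\<lambda>w::complex. 1 / (1 - w)"
  have "deriv (cesaro_like \<mu> (\<lambda>w. 1)) (of_real r) =
      (\<integral>t. of_real t * deriv ?F (of_real t * of_real r) \<partial>\<mu>)"
    using r by (intro DERIV_imp_deriv cesaro_like_has_field_derivative) auto
  also have "\<dots> = (\<integral>t. complex_of_real (t * (1 / (1 - t * r)\<^sup>2)) \<partial>\<mu>)"
  proof (rule Bochner_Integration.integral_cong[OF refl])
    fix t assume "t \<in> space \<mu>"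
    then have "t * r < 1" using r mult_left_le_one_le[of r t] by (auto simp: space_eq)
    then have ne: "1 - complex_of_real (t * r) \<noteq> 0"
      by (metis eq_iff_diff_eq_0 less_irrefl of_real_1 of_real_eq_iff)
    have "deriv ?F (of_real (t * r)) = 1 / (1 - of_real (t * r))\<^sup>2"
      using ne by (intro DERIV_imp_deriv) (auto intro!: derivative_eq_intros simp: power2_eq_square)
    then show "of_real t * deriv ?F (of_real t * of_real r) = complex_of_real (t * (1 / (1 - t * r)\<^sup>2))"
      by simp
  qed
  also have "\<dots> = of_real (\<integral>t. t * (1 / (1 - t * r)\<^sup>2) \<partial>\<mu>)"
    by (rule integral_complex_of_real)
  finally show ?thesis .
qed

lemma tail_le_if_cesaro_like_one:
  assumes \<beta>: "0 < \<beta>" "\<beta> < 2" and one: "cesaro_like \<mu> (\<lambda>w. 1) \<in> bloch_space \<beta>"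
  shows "\<exists>M. \<forall>t. 0 \<le> t \<longrightarrow> t < 1 \<longrightarrow> measure \<mu> {t..<1} \<le> M * (1 - t) powr (2 - \<beta>)"
proof -
  define C where "C = bloch_norm \<beta> (cesaro_like \<mu> (\<lambda>w. 1))"
  define m where "m = measure \<mu> (space \<mu>)"
  \<comment> \<open>The first summand handles r \<ge> 1/2; the second handles r < 1/2, where 2 (1 -
    r) > 1 and the total mass suffices.\<close>
  define M where "M = 8 * C + m * 2 powr (2 - \<beta>)"
  have C0: "0 \<le> C" using bloch_norm_nonneg[OF one] by (simp add: C_def)
  have m0: "0 \<le> m" by (simp add: m_def)
  have "measure \<mu> {r..<1} \<le> M * (1 - r) powr (2 - \<beta>)" if r: "0 \<le> r" "r < 1" for r
  proof (cases "r < 1 / 2")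
    case True
    have "1 = (2 * (1 / 2)) powr (2 - \<beta>)" by simp
    also have "\<dots> \<le> (2 * (1 - r)) powr (2 - \<beta>)" using True \<beta> by (intro powr_mono2) auto
    also have "\<dots> = 2 powr (2 - \<beta>) * (1 - r) powr (2 - \<beta>)" by (rule powr_mult)
    finally have "m * 1 \<le> m * (2 powr (2 - \<beta>) * (1 - r) powr (2 - \<beta>))"
      by (rule mult_left_mono[OF _ m0])
    moreover have "measure \<mu> {r..<1} \<le> m" unfolding m_def by (rule bounded_measure)
    moreover have "0 \<le> 8 * C * (1 - r) powr (2 - \<beta>)" using C0 by simp
    ultimately show ?thesis unfolding M_def distrib_right mult.assoc by linarith
  next
    case False
    let ?\<delta> = "1 - r"
    have \<delta>: "0 < ?\<delta>" using r by simp
    let ?I = "\<integral>t. t * (1 / (1 - t * r)\<^sup>2) \<partial>\<mu>"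
    have set: "{r..<1} \<in> sets \<mu>" using r by (auto simp: sets_iff)
    \<comment> \<open>On the tail t \<ge> 1/2 and 1 - t r \<le> 1 - r^2 \<le> 2 (1 - r), hence the
      integrand is at least 1/2 * 1/(2 (1 - r))^2; this is the origin of the 8.\<close>
    have "1 / (8 * ?\<delta>\<^sup>2) * measure \<mu> {r..<1} = (\<integral>t. indicator {r..<1} t * (1 / (8 * ?\<delta>\<^sup>2)) \<partial>\<mu>)"
      using set by (simp add: integral_mult_left_zero)
    also have "\<dots> \<le> ?I"
    proof (rule Bochner_Integration.integral_mono)
      show "integrable \<mu> (\<lambda>t. indicator {r..<1} t * (1 / (8 * ?\<delta>\<^sup>2)))"
        using set by (intro integrable_mult_left integrable_real_indicator) (auto simp: emeasure_eq_measure)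
      show "integrable \<mu> (\<lambda>t. t * (1 / (1 - t * r)\<^sup>2))"
      proof (rule Bochner_Integration.integrable_bound[OF integrable_kernel[OF r]])
        show "(\<lambda>t. t * (1 / (1 - t * r)\<^sup>2)) \<in> borel_measurable \<mu>"
          by (rule borel_measurable_if_borel) measurable
        show "AE t in \<mu>. norm (t * (1 / (1 - t * r)\<^sup>2)) \<le> norm (1 / (1 - t * r)\<^sup>2)"
          by (rule AE_I2) (auto simp: space_eq abs_mult divide_right_mono)
      qed
      fix t assume "t \<in> space \<mu>"
      then have t: "0 \<le> t" "t < 1" by (auto simp: space_eq)
      show "indicator {r..<1} t * (1 / (8 * ?\<delta>\<^sup>2)) \<le> t * (1 / (1 - t * r)\<^sup>2)"
      proof (cases "r \<le> t")
        case True
        have "r * r \<le> t * r" using True r by (intro mult_right_mono) auto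
        moreover have "1 - r * r \<le> 2 * ?\<delta>"
          using zero_le_square[of "1 - r"] by (simp add: algebra_simps)
        ultimately have "1 - t * r \<le> 2 * ?\<delta>" by linarith
        moreover have "t * r < 1" using t r mult_left_le_one_le[of r t] by linarith
        ultimately have "1 / (2 * ?\<delta>)\<^sup>2 \<le> 1 / (1 - t * r)\<^sup>2"
          by (intro divide_left_mono power_mono mult_pos_pos zero_less_power) (use \<delta> in auto)
        then have "1 / 2 * (1 / (2 * ?\<delta>)\<^sup>2) \<le> t * (1 / (1 - t * r)\<^sup>2)"
          using True False by (intro mult_mono) auto
        moreover have "1 / 2 * (1 / (2 * d)\<^sup>2) = 1 / (8 * d\<^sup>2)" for d :: real
          by (simp add: power_mult_distrib)
        ultimately have "1 / (8 * ?\<delta>\<^sup>2) \<le> t * (1 / (1 - t * r)\<^sup>2)"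
          by (simp only:)
        then show ?thesis using True t by simp
      qed (use t in auto)
    qed
    finally have I: "1 / (8 * ?\<delta>\<^sup>2) * measure \<mu> {r..<1} \<le> ?I" .
    then have "0 \<le> ?I" by (rule order_trans[rotated]) simp
    have "(1 - r\<^sup>2) powr \<beta> * ?I \<le> C"
      using bloch_norm_ge[OF one, of "of_real r"] r \<open>0 \<le> ?I\<close>
        norm_ge_zero[of "cesaro_like \<mu> (\<lambda>w. 1) 0"]
      unfolding deriv_cesaro_like_one[OF r] C_def[symmetric] norm_of_real by (simp del: norm_ge_zero)
    moreover have "?\<delta> powr \<beta> \<le> (1 - r\<^sup>2) powr \<beta>"
      using r \<beta> by (intro powr_mono2) (auto simp: power2_eq_square mult_left_le_one_le)
    ultimately have "?\<delta> powr \<beta> * ?I \<le> C"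
      using \<open>0 \<le> ?I\<close> by (meson mult_right_mono order_trans)
    moreover have "?\<delta> powr \<beta> * (1 / (8 * ?\<delta>\<^sup>2) * measure \<mu> {r..<1}) \<le> ?\<delta> powr \<beta> * ?I"
      by (intro mult_left_mono I) auto
    ultimately have "?\<delta> powr \<beta> * (1 / (8 * ?\<delta>\<^sup>2) * measure \<mu> {r..<1}) \<le> C" by linarith
    then have "measure \<mu> {r..<1} \<le> 8 * C * (?\<delta>\<^sup>2 / ?\<delta> powr \<beta>)"
      using \<delta> by (simp add: field_simps)
    also have "?\<delta>\<^sup>2 / ?\<delta> powr \<beta> = ?\<delta> powr (2 - \<beta>)"
      using \<delta> by (simp add: powr_diff)
    also have "8 * C * ?\<delta> powr (2 - \<beta>) \<le> M * ?\<delta> powr (2 - \<beta>)"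
      using m0 by (intro mult_right_mono) (auto simp: M_def)
    finally show ?thesis .
  qed
  then show ?thesis by blast
qed

text \<open>The operator factors through the bounded functions with the supremum norm: the embedding
  is compact and the second map is bounded. The limit \<open>f\<close> is therefore only required to
  be bounded and holomorphic, and its image is the limit in the target space.\<close>

lemma bloch_operator_if_tail_le:
  assumes \<alpha>: "0 < \<alpha>" "\<alpha> < 1" and \<beta>: "0 < \<beta>" "\<beta> < 2"
    and M: "\<And>t. 0 \<le> t \<Longrightarrow> t < 1 \<Longrightarrow> measure \<mu> {t..<1} \<le> M * (1 - t) powr (2 - \<beta>)"
  shows "bloch_bounded_operator \<alpha> \<beta> (cesaro_like \<mu>)"
    and "bloch_compact_operator \<alpha> \<beta> (cesaro_like \<mu>)"
proof -
  obtain K where K: "K \<ge> 0" and bound: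
    "\<And>h A. h holomorphic_on ball 0 1 \<Longrightarrow> (\<And>w. cmod w < 1 \<Longrightarrow> cmod (h w) \<le> A) \<Longrightarrow>
      cesaro_like \<mu> h \<in> bloch_space \<beta> \<and> bloch_norm \<beta> (cesaro_like \<mu> h) \<le> K * A"
    using bloch_norm_cesaro_like_le[OF \<beta> M] by metis
  have op: "cesaro_like \<mu> f \<in> bloch_space \<beta> \<and>
      bloch_norm \<beta> (cesaro_like \<mu> f) \<le> K * ((1 + 1 / (1 - \<alpha>)) * bloch_norm \<alpha> f)"
    if f: "f \<in> bloch_space \<alpha>" for f
    using \<alpha> by (intro bound bloch_space_holomorphic[OF f] norm_le_bloch_norm[OF f]) auto
  show "bloch_bounded_operator \<alpha> \<beta> (cesaro_like \<mu>)"
    unfolding bloch_bounded_operator_def using op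
    by (auto intro!: exI[of _ "K * (1 + 1 / (1 - \<alpha>))"] simp: mult.assoc)
  show "bloch_compact_operator \<alpha> \<beta> (cesaro_like \<mu>)"
    unfolding bloch_compact_operator_def
  proof (intro conjI allI impI ballI)
    fix F :: "nat \<Rightarrow> complex \<Rightarrow> complex"
    assume "(\<forall>n. F n \<in> bloch_space \<alpha>) \<and> (\<exists>C. \<forall>n. bloch_norm \<alpha> (F n) \<le> C)"
    then obtain C where F: "\<And>n. F n \<in> bloch_space \<alpha>" and C: "\<And>n. bloch_norm \<alpha> (F n) \<le> C"
      by blast
    obtain f r where f: "f holomorphic_on ball 0 1" and r: "strict_mono (r :: nat \<Rightarrow> nat)"
      and unif: "uniform_limit (ball 0 1) (\<lambda>n. F (r n)) f sequentially"
      and fb: "\<And>z. cmod z < 1 \<Longrightarrow> cmod (f z) \<le> (1 + 1 / (1 - \<alpha>)) * C"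
      by (rule bloch_bounded_uniformly_convergent_subseq[where F = F, OF less_imp_le[OF \<alpha>(1)] \<alpha>(2) F C])
        (rule that)
    have "(\<lambda>n. bloch_norm \<beta> (\<lambda>z. cesaro_like \<mu> (F (r n)) z - cesaro_like \<mu> f z)) \<longlonglongrightarrow> 0"
    proof (rule tendstoI)
      fix e :: real assume e: "e > 0"
      \<comment> \<open>Using K + 1 in the denominator keeps \<open>d\<close> well defined and
        positive when K = 0.\<close>
      define d where "d = e / (2 * (K + 1))"
      have d: "d > 0" "K * d < e"
        using e K by (auto simp: d_def field_simps intro!: add_nonneg_pos)
      have "\<forall>\<^sub>F n in sequentially. \<forall>z\<in>ball 0 1. dist (F (r n) z) (f z) < d"
        using unif d(1) by (auto simp: uniform_limit_iff)
      then show "\<forall>\<^sub>F n in sequentially.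
          dist (bloch_norm \<beta> (\<lambda>z. cesaro_like \<mu> (F (r n)) z - cesaro_like \<mu> f z)) 0 < e"
      proof eventually_elim
        case (elim n)
        let ?h = "\<lambda>z. F (r n) z - f z"
        have Fr: "F (r n) holomorphic_on ball 0 1" by (rule bloch_space_holomorphic[OF F])
        have "cmod (?h z) \<le> d" if "cmod z < 1" for z
          using bspec[OF elim, of z] that by (simp add: dist_norm)
        then have h: "cesaro_like \<mu> ?h \<in> bloch_space \<beta>" "bloch_norm \<beta> (cesaro_like \<mu> ?h) \<le> K * d"
          using bound[OF holomorphic_on_diff[OF Fr f]] by blast+
        \<comment> \<open>The two functions are known to agree only inside the disc, where both
          series converge.\<close>
        have "bloch_norm \<beta> (\<lambda>z. cesaro_like \<mu> (F (r n)) z - cesaro_like \<mu> f z) =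
            bloch_norm \<beta> (cesaro_like \<mu> ?h)"
          by (rule bloch_norm_cong) (simp add: cesaro_like_diff[OF Fr f])
        then show ?case using h d bloch_norm_nonneg[OF h(1)] by (simp add: dist_real_def)
      qed
    qed
    moreover have "cesaro_like \<mu> f \<in> bloch_space \<beta>" using bound[OF f fb] by blast
    ultimately show "\<exists>g\<in>bloch_space \<beta>. \<exists>r :: nat \<Rightarrow> nat. strict_mono r \<and>
        (\<lambda>n. bloch_norm \<beta> (\<lambda>z. cesaro_like \<mu> (F (r n)) z - g z)) \<longlonglongrightarrow> 0"
      using r by blast
  qed (use op in blast)
qed

end

theorem theorem3p1:
  fixes \<mu> :: "real measure" and \<alpha> \<beta> :: real
  assumes "finite_measure \<mu>"
    and "sets \<mu> = sets (restrict_space borel {0..<1})"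
    and "0 < \<alpha>" "\<alpha> < 1" "0 < \<beta>" "\<beta> < 2"
  shows "(bloch_bounded_operator \<alpha> \<beta> (cesaro_like \<mu>) \<longleftrightarrow>
            bloch_compact_operator \<alpha> \<beta> (cesaro_like \<mu>)) \<and>
         (bloch_compact_operator \<alpha> \<beta> (cesaro_like \<mu>) \<longleftrightarrow>
            carleson_measure (2 - \<beta>) (measure_on_disc \<mu>))"
proof -
  interpret unit_interval_measure \<mu>
    using assms(1,2) by (simp add: unit_interval_measure_def unit_interval_measure_axioms_def)
  have one: "(\<lambda>w. 1) \<in> bloch_space \<alpha>"
    by (rule bloch_space_norm_leI[where B = 0]) auto
  let ?tail = "\<exists>M. \<forall>t. 0 \<le> t \<longrightarrow> t < 1 \<longrightarrow> measure \<mu> {t..<1} \<le> M * (1 - t) powr (2 - \<beta>)"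
  \<comment> \<open>Boundedness and compactness both include mapping into the target space, so
    either one places the image of the constant 1 there, which forces the tail estimate and closes
    the cycle of implications.\<close>
  have "?tail" if "bloch_bounded_operator \<alpha> \<beta> (cesaro_like \<mu>) \<or>
      bloch_compact_operator \<alpha> \<beta> (cesaro_like \<mu>)"
    using that one assms(5,6)
    by (intro tail_le_if_cesaro_like_one)
      (auto simp: bloch_bounded_operator_def bloch_compact_operator_def)
  moreover have "bloch_bounded_operator \<alpha> \<beta> (cesaro_like \<mu>) \<and>
      bloch_compact_operator \<alpha> \<beta> (cesaro_like \<mu>)" if ?tail
    using that bloch_operator_if_tail_le[OF assms(3-6)] by blast
  ultimately show ?thesis unfolding carleson_measure_iff by blast
qed

end
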